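(* Let $X$ be a topological space. The penalty function $F_\lambda=f+\lambda\varphi$ is (globally) exact if and only if the following two conditions are satisfied: (1) $F_\mu$ is bounded below on $A$ for some $\mu\ge0$; (2) the penalty function $F_\lambda$ is exact on $\Omega_\delta=\{x\in A\mid\varphi(x)<\delta\}$ for some $\delta>0$. Moreover, for such $\mu$ and $\delta$ one has $$\lambda^*(f,\varphi)\le\max\left\{\lambda^*(\Omega_\delta),\ \mu+\frac{f^*-c}{\delta}\right\},$$ where $c=\inf_{x\in A}F_\mu(x)$.
   Context: $M,A\subset X$ are nonempty, $f\colon X\to\mathbb{R}\cup\{+\infty\}$, $\varphi\colon X\to[0,+\infty)$ with $M=\{x\in X\mid\varphi(x)=0\}$, $\Omega=M\cap A$, $f^*=\inf_{x\in\Omega}f(x)$, $F_\lambda(x)=f(x)+\lambda\varphi(x)$ for $\lambda\ge0$. The problem $(\mathcal{P})$ is: $\min f(x)$ subject to $x\in M$, $x\in A$. Standing assumptions: $f(x)<+\infty$ for some $x\in\Omega$, and $f$ attains a global minimum on $\Omega$. $F_\lambda$ is (globally) exact if there exists $\lambda_0\ge0$ such that for every $\lambda>\lambda_0$ the set of global minimizers of $F_\lambda$ on $A$ coincides with the set of globally optimal solutions of $(\mathcal{P})$; the infimum of all such $\lambda_0\ge 0$ is denoted $\lambda^*(f,\varphi)$. For a nonempty set $C\subset A$, $F_\lambda$ is exact on $C$ if there exists $\lambda^*\ge0$ such that for every $\lambda\ge\lambda^*$ one has $F_\lambda(x)\ge f^*$ for all $x\in C$; the infimum of all such $\lambda^*\ge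 0$ is denoted $\lambda^*(C)$. *)

theory Defs
  imports "HOL-Library.Extended_Real"
begin

text \<open>
  The problem is to minimise \<open>f\<close> over \<open>M \<inter> A\<close>. Values in the reals extended by
  \<open>+\<infinity>\<close> are modelled by \<^typ>\<open>ereal\<close> together with the hypothesis \<open>f x \<noteq> -\<infinity>\<close>
  in the theorem.
\<close>

definition penalty :: "('a \<Rightarrow> ereal) \<Rightarrow> ('a \<Rightarrow> real) \<Rightarrow> real \<Rightarrow> 'a \<Rightarrow> ereal" where
  "penalty f \<phi> l x = f x + ereal (l * \<phi> x)"

definition global_minimizers :: "('a \<Rightarrow> ereal) \<Rightarrow> 'a set \<Rightarrow> 'a set" where
  "global_minimizers g S = {x. is_arg_min g (\<lambda>y. y \<in> S) x}"

definition optimal_value :: "('a \<Rightarrow> ereal) \<Rightarrow> 'a set \<Rightarrow> 'a set \<Rightarrow> ereal" where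
  "optimal_value f M A = (INF x\<in>M \<inter> A. f x)"

text \<open>
  The bound has to be a real number: every set of extended reals is bounded below by
  \<open>-\<infinity>\<close>, so \<^const>\<open>bdd_below\<close> on \<^typ>\<open>ereal\<close> would be vacuous.
\<close>

definition bounded_below_on :: "('a \<Rightarrow> ereal) \<Rightarrow> 'a set \<Rightarrow> bool" where
  "bounded_below_on g S \<longleftrightarrow> (\<exists>r::real. \<forall>x\<in>S. ereal r \<le> g x)"

definition global_threshold ::
  "('a \<Rightarrow> ereal) \<Rightarrow> ('a \<Rightarrow> real) \<Rightarrow> 'a set \<Rightarrow> 'a set \<Rightarrow> real \<Rightarrow> bool" where
  "global_threshold f \<phi> M A l0 \<longleftrightarrow>
     0 \<le> l0 \<and>
     (\<forall>l>l0. global_minimizers (penalty f \<phi> l) A = global_minimizers f (M \<inter> A))"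

definition globally_exact ::
  "('a \<Rightarrow> ereal) \<Rightarrow> ('a \<Rightarrow> real) \<Rightarrow> 'a set \<Rightarrow> 'a set \<Rightarrow> bool" where
  "globally_exact f \<phi> M A \<longleftrightarrow> (\<exists>l0. global_threshold f \<phi> M A l0)"

text \<open>
  The infima of thresholds are taken in \<^typ>\<open>ereal\<close>, so they are \<open>+\<infinity>\<close> if
  there is no threshold at all, rather than an unspecified real number.
\<close>

definition global_exactness_param ::
  "('a \<Rightarrow> ereal) \<Rightarrow> ('a \<Rightarrow> real) \<Rightarrow> 'a set \<Rightarrow> 'a set \<Rightarrow> ereal" where
  "global_exactness_param f \<phi> M A = Inf (ereal ` {l0. global_threshold f \<phi> M A l0})"

definition threshold_on ::
  "('a \<Rightarrow> ereal) \<Rightarrow> ('a \<Rightarrow> real) \<Rightarrow> 'a set \<Rightarrow> 'a set \<Rightarrow> 'a set \<Rightarrow> real \<Rightarrow> bool" where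
  "threshold_on f \<phi> M A C l0 \<longleftrightarrow>
     0 \<le> l0 \<and> (\<forall>l\<ge>l0. \<forall>x\<in>C. optimal_value f M A \<le> penalty f \<phi> l x)"

definition exact_on ::
  "('a \<Rightarrow> ereal) \<Rightarrow> ('a \<Rightarrow> real) \<Rightarrow> 'a set \<Rightarrow> 'a set \<Rightarrow> 'a set \<Rightarrow> bool" where
  "exact_on f \<phi> M A C \<longleftrightarrow> (\<exists>l0. threshold_on f \<phi> M A C l0)"

definition exactness_param_on ::
  "('a \<Rightarrow> ereal) \<Rightarrow> ('a \<Rightarrow> real) \<Rightarrow> 'a set \<Rightarrow> 'a set \<Rightarrow> 'a set \<Rightarrow> ereal" where
  "exactness_param_on f \<phi> M A C = Inf (ereal ` {l0. threshold_on f \<phi> M A C l0})"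

definition penalty_sublevel :: "('a \<Rightarrow> real) \<Rightarrow> 'a set \<Rightarrow> real \<Rightarrow> 'a set" where
  "penalty_sublevel \<phi> A \<delta> = {x \<in> A. \<phi> x < \<delta>}"

end

theory Submission
  imports Defs
begin

text \<open>
  A value \<open>l\<close> with \<open>F\<^sub>l \<ge> f\<^sup>*\<close> on all of \<open>A\<close> is a threshold for global exactness: beyond \<open>l\<close>,
  points outside \<open>M\<close> are strictly penalised, so the value \<open>f\<^sup>*\<close> is only attained inside \<open>M\<close>.
  Local exactness gives this bound where \<open>\<phi> < \<delta>\<close>; where \<open>\<phi> \<ge> \<delta>\<close> one has
  \<open>F\<^sub>l \<ge> c + (l - \<mu>) \<delta>\<close>, which is at least \<open>f\<^sup>*\<close> as soon as \<open>l \<ge> \<mu> + (f\<^sup>* - c) / \<delta>\<close>.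
\<close>

lemma mem_global_minimizers:
  "x \<in> global_minimizers g S \<longleftrightarrow> x \<in> S \<and> (\<forall>y\<in>S. g x \<le> g y)"
  by (auto simp: global_minimizers_def is_arg_min_linorder)

lemma optimal_value_eq:
  assumes "z \<in> global_minimizers f (M \<inter> A)"
  shows "optimal_value f M A = f z"
  using assms unfolding optimal_value_def mem_global_minimizers
  by (intro antisym INF_lower INF_greatest) auto

lemma penalty_mono:
  assumes "0 \<le> \<phi> x" and "l \<le> l'"
  shows "penalty f \<phi> l x \<le> penalty f \<phi> l' x"
  unfolding penalty_def using assms by (intro add_left_mono) (simp add: mult_right_mono)

text \<open>Finiteness of \<open>f x\<close> is what gives strictness: at
  \<open>f x = \<infinity>\<close> both sides would be \<open>\<infinity>\<close>.\<close>

lemma penalty_strict_mono: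
  assumes "f x \<noteq> -\<infinity>" and "f x \<noteq> \<infinity>" and "0 < \<phi> x" and "l < l'"
  shows "penalty f \<phi> l x < penalty f \<phi> l' x"
  using assms by (cases "f x") (auto simp: penalty_def)

text \<open>The bound is asked at \<open>l0\<close> itself, while a threshold only concerns
  \<open>l > l0\<close>; this gap supplies the strict inequality off \<open>M\<close>.\<close>

lemma global_thresholdI:
  assumes fin: "\<And>x. f x \<noteq> -\<infinity>" and nonneg: "\<And>x. 0 \<le> \<phi> x" and M: "M = {x. \<phi> x = 0}"
    and z: "z \<in> global_minimizers f (M \<inter> A)" and fz: "f z \<noteq> \<infinity>"
    and "0 \<le> l0" and lb: "\<And>x. x \<in> A \<Longrightarrow> f z \<le> penalty f \<phi> l0 x"
  shows "global_threshold f \<phi> M A l0"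
  unfolding global_threshold_def
proof (intro conjI allI impI set_eqI)
  fix l x assume "l0 < l"
  have lb': "f z \<le> penalty f \<phi> l y" if "y \<in> A" for y
    using lb[OF that] penalty_mono[of \<phi> y, OF nonneg less_imp_le[OF \<open>l0 < l\<close>]] by (rule order_trans)
  have eq: "penalty f \<phi> l y = f y" if "y \<in> M" for y
    using that M by (simp add: penalty_def)
  have zM: "z \<in> M" "z \<in> A" and zmin: "\<And>y. y \<in> M \<inter> A \<Longrightarrow> f z \<le> f y"
    using z by (auto simp: mem_global_minimizers)
  have outside: "f z < penalty f \<phi> l y" if "y \<in> A" "y \<notin> M" for y
  \<comment> \<open>An infinite \<open>f y\<close> already exceeds the finite \<open>f z\<close>;
    otherwise raising the parameter from \<open>l0\<close> to \<open>l\<close> strictly raises the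
    penalty at \<open>y\<close>.\<close>
  proof (cases "f y = \<infinity>")
    case True
    then show ?thesis using fz by (simp add: penalty_def less_top)
  next
    case False
    have "0 < \<phi> y" using that M nonneg[of y] by (simp add: order_less_le)
    show ?thesis
      using lb[OF \<open>y \<in> A\<close>] penalty_strict_mono[of f y \<phi>, OF fin False \<open>0 < \<phi> y\<close> \<open>l0 < l\<close>]
      by (rule order_le_less_trans)
  qed
  \<comment> \<open>The minimum of \<open>penalty f \<phi> l\<close> on \<open>A\<close> is
    \<open>f z\<close>, attained at \<open>z\<close>, so its minimizers are the points of value at
    most \<open>f z\<close>. These lie in \<open>M\<close>, where the penalty term vanishes.\<close>
  have "x \<in> global_minimizers (penalty f \<phi> l) A \<longleftrightarrow> x \<in> A \<and> penalty f \<phi> l x \<le> f z"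
    unfolding mem_global_minimizers using lb' eq[OF zM(1)] zM(2) by (auto intro: order_trans)
  also have "\<dots> \<longleftrightarrow> x \<in> M \<inter> A \<and> f x \<le> f z"
    using outside[of x] eq[of x] by (cases "x \<in> M") (auto simp: not_le)
  also have "\<dots> \<longleftrightarrow> x \<in> global_minimizers f (M \<inter> A)"
    unfolding mem_global_minimizers using zM zmin by (auto intro: order_trans)
  finally show "x \<in> global_minimizers (penalty f \<phi> l) A \<longleftrightarrow> x \<in> global_minimizers f (M \<inter> A)" .
qed (use \<open>0 \<le> l0\<close> in simp)

text \<open>The point \<open>z\<close> also minimizes \<open>penalty f \<phi> l\<close> on
  \<open>A\<close>, and its value there is \<open>f z\<close> because
  \<open>\<phi> z = 0\<close>.\<close>

lemma global_threshold_lower_bound: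
  assumes "global_threshold f \<phi> M A l0" and "l0 < l"
    and "z \<in> global_minimizers f (M \<inter> A)" and "\<phi> z = 0" and "x \<in> A"
  shows "f z \<le> penalty f \<phi> l x"
proof -
  have "z \<in> global_minimizers (penalty f \<phi> l) A"
    using assms(1-3) by (simp add: global_threshold_def)
  then have "penalty f \<phi> l z \<le> penalty f \<phi> l x"
    using \<open>x \<in> A\<close> by (simp add: mem_global_minimizers)
  then show ?thesis using \<open>\<phi> z = 0\<close> by (simp add: penalty_def)
qed

text \<open>Passing from \<open>\<mu>\<close> to \<open>l\<close> adds
  \<open>(l - \<mu>) * \<phi> x\<close>. Since
  \<open>l - \<mu> \<ge> (v - c) / \<delta> \<ge> 0\<close> and
  \<open>\<phi> x \<ge> \<delta>\<close>, this gain is at least \<open>v - c\<close>.\<close>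

lemma penalty_lower_bound_far:
  assumes "ereal c \<le> penalty f \<phi> \<mu> x" and "0 < \<delta>" and "\<delta> \<le> \<phi> x" and "c \<le> v"
    and "\<mu> + (v - c) / \<delta> \<le> l"
  shows "ereal v \<le> penalty f \<phi> l x"
proof (cases "f x")
  case (real r)
  have "0 \<le> (v - c) / \<delta>" using assms(2,4) by simp
  have "v - c = (v - c) / \<delta> * \<delta>" using \<open>0 < \<delta>\<close> by simp
  also have "\<dots> \<le> (l - \<mu>) * \<phi> x"
    using assms(2,3,5) \<open>0 \<le> (v - c) / \<delta>\<close> by (intro mult_mono) linarith+
  finally show ?thesis
    using assms(1) real by (simp add: penalty_def algebra_simps)
qed (use assms(1) in \<open>auto simp: penalty_def\<close>)

text \<open>Here \<open>c\<close> is any real lower bound: an arbitrary one yields exactness, and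
  the infimum yields the quantitative estimate.\<close>

lemma global_threshold_max:
  assumes fin: "\<And>x. f x \<noteq> -\<infinity>" and nonneg: "\<And>x. 0 \<le> \<phi> x" and M: "M = {x. \<phi> x = 0}"
    and z: "z \<in> global_minimizers f (M \<inter> A)" and v: "f z = ereal v"
    and "0 < \<delta>" and c: "\<And>x. x \<in> A \<Longrightarrow> ereal c \<le> penalty f \<phi> \<mu> x"
    and l1: "threshold_on f \<phi> M A (penalty_sublevel \<phi> A \<delta>) l1"
  shows "global_threshold f \<phi> M A (max l1 (\<mu> + (v - c) / \<delta>))"
proof (rule global_thresholdI[OF fin nonneg M z])
  show "f z \<noteq> \<infinity>" using v by simp
  show "0 \<le> max l1 (\<mu> + (v - c) / \<delta>)" using l1 by (simp add: threshold_on_def le_max_iff_disj)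
  have zA: "z \<in> A" "\<phi> z = 0" using z M by (auto simp: mem_global_minimizers)
  \<comment> \<open>Evaluate the lower bound at \<open>z\<close>, where the penalty
    vanishes.\<close>
  have "c \<le> v" using c[OF zA(1)] zA(2) v by (simp add: penalty_def)
  fix x assume "x \<in> A"
  show "f z \<le> penalty f \<phi> (max l1 (\<mu> + (v - c) / \<delta>)) x"
  proof (cases "\<phi> x < \<delta>")
    case True
    then have "x \<in> penalty_sublevel \<phi> A \<delta>"
      using \<open>x \<in> A\<close> by (simp add: penalty_sublevel_def)
    then show ?thesis
      using l1 max.cobounded1 unfolding threshold_on_def optimal_value_eq[OF z] by blast
  next
    case False
    then have "\<delta> \<le> \<phi> x" by simp
    from penalty_lower_bound_far[OF c[OF \<open>x \<in> A\<close>] \<open>0 < \<delta>\<close> this \<open>c \<le> v\<close> max.cobounded2]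
    show ?thesis unfolding v .
  qed
qed

theorem lemma3p15:
  fixes f :: "'a::topological_space \<Rightarrow> ereal"
    and \<phi> :: "'a \<Rightarrow> real"
    and M A :: "'a set"
  assumes "M \<noteq> {}" and "A \<noteq> {}"
    and "\<And>x. f x \<noteq> -\<infinity>"
    and "\<And>x. 0 \<le> \<phi> x"
    and "M = {x. \<phi> x = 0}"
    and "\<exists>x\<in>M \<inter> A. f x < \<infinity>"
    and "global_minimizers f (M \<inter> A) \<noteq> {}"
  shows "(globally_exact f \<phi> M A \<longleftrightarrow>
            (\<exists>\<mu>\<ge>0. bounded_below_on (penalty f \<phi> \<mu>) A) \<and>
            (\<exists>\<delta>>0. exact_on f \<phi> M A (penalty_sublevel \<phi> A \<delta>)))
       \<and> (\<forall>\<mu>\<ge>0. \<forall>\<delta>>0.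
            bounded_below_on (penalty f \<phi> \<mu>) A \<longrightarrow>
            exact_on f \<phi> M A (penalty_sublevel \<phi> A \<delta>) \<longrightarrow>
            global_exactness_param f \<phi> M A
              \<le> max (exactness_param_on f \<phi> M A (penalty_sublevel \<phi> A \<delta>))
                    (ereal \<mu> + (optimal_value f M A - (INF x\<in>A. penalty f \<phi> \<mu> x)) / ereal \<delta>))"
proof -
  obtain z where z: "z \<in> global_minimizers f (M \<inter> A)" using assms(7) by blast
  have zA: "z \<in> A" "\<phi> z = 0" using z assms(5) by (auto simp: mem_global_minimizers)
  have "f z < \<infinity>"
    using assms(6) z unfolding mem_global_minimizers by (metis order_le_less_trans)
  then obtain v where v: "f z = ereal v" using assms(3)[of z] by (cases "f z") auto
  have opt: "optimal_value f M A = ereal v" using optimal_value_eq[OF z] v by simp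
  note threshold = global_threshold_max[OF assms(3,4,5) z v]
  have "\<exists>\<mu>\<ge>0. bounded_below_on (penalty f \<phi> \<mu>) A"
    and "\<exists>\<delta>>0. exact_on f \<phi> M A (penalty_sublevel \<phi> A \<delta>)"
    if exact: "globally_exact f \<phi> M A"
  proof -
    obtain l0 where l0: "global_threshold f \<phi> M A l0"
      using exact unfolding globally_exact_def by blast
    have "0 \<le> l0" using l0 by (simp add: global_threshold_def)
    \<comment> \<open>A global threshold says nothing at \<open>l0\<close> itself, whereas exactness
      on a set includes its endpoint; the shift by 1 bridges the two.\<close>
    have lb: "ereal v \<le> penalty f \<phi> l x" if "l \<ge> l0 + 1" "x \<in> A" for l x
      using global_threshold_lower_bound[OF l0 _ z zA(2) that(2), of l] that(1) v by simp
    have "bounded_below_on (penalty f \<phi> (l0 + 1)) A"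
      unfolding bounded_below_on_def using lb by blast
    then show "\<exists>\<mu>\<ge>0. bounded_below_on (penalty f \<phi> \<mu>) A"
      using \<open>0 \<le> l0\<close> by (intro exI[of _ "l0 + 1"]) simp
    \<comment> \<open>The bound holds on all of \<open>A\<close>, so any positive
      \<open>\<delta>\<close> would do; 1 is chosen.\<close>
    have "threshold_on f \<phi> M A (penalty_sublevel \<phi> A 1) (l0 + 1)"
      using lb \<open>0 \<le> l0\<close> by (simp add: threshold_on_def opt penalty_sublevel_def)
    then show "\<exists>\<delta>>0. exact_on f \<phi> M A (penalty_sublevel \<phi> A \<delta>)"
      unfolding exact_on_def using zero_less_one by blast
  qed
  moreover have "globally_exact f \<phi> M A"
    if bd: "bounded_below_on (penalty f \<phi> \<mu>) A" and \<delta>: "0 < \<delta>"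
      and exact: "exact_on f \<phi> M A (penalty_sublevel \<phi> A \<delta>)" for \<mu> \<delta>
  proof -
    obtain c where "\<And>x. x \<in> A \<Longrightarrow> ereal c \<le> penalty f \<phi> \<mu> x"
      using bd unfolding bounded_below_on_def by blast
    moreover obtain l1 where "threshold_on f \<phi> M A (penalty_sublevel \<phi> A \<delta>) l1"
      using exact unfolding exact_on_def by blast
    ultimately show ?thesis
      unfolding globally_exact_def using threshold[OF \<delta>, of c \<mu> l1] by blast
  qed
  moreover have "global_exactness_param f \<phi> M A
              \<le> max (exactness_param_on f \<phi> M A (penalty_sublevel \<phi> A \<delta>))
                    (ereal \<mu> + (optimal_value f M A - (INF x\<in>A. penalty f \<phi> \<mu> x)) / ereal \<delta>)"
    if bd: "bounded_below_on (penalty f \<phi> \<mu>) A" and \<delta>: "0 < \<delta>" for \<mu> \<delta>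
  proof -
    \<comment> \<open>The infimum is finite, lying between a real lower bound and the value at
      \<open>z\<close>, so the estimate becomes one between real numbers.\<close>
    obtain r where "ereal r \<le> (INF x\<in>A. penalty f \<phi> \<mu> x)"
      using bd by (auto simp: bounded_below_on_def intro: INF_greatest)
    moreover have "(INF x\<in>A. penalty f \<phi> \<mu> x) \<le> ereal v"
      using INF_lower[OF zA(1), of "penalty f \<phi> \<mu>"] zA(2) v by (simp add: penalty_def)
    ultimately obtain c where c: "(INF x\<in>A. penalty f \<phi> \<mu> x) = ereal c"
      by (cases "INF x\<in>A. penalty f \<phi> \<mu> x") auto
    have c_le: "ereal c \<le> penalty f \<phi> \<mu> x" if "x \<in> A" for x
      unfolding c[symmetric] using that by (rule INF_lower)
    define \<nu> where "\<nu> = \<mu> + (v - c) / \<delta>"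
    have \<nu>: "ereal \<mu> + (optimal_value f M A - (INF x\<in>A. penalty f \<phi> \<mu> x)) / ereal \<delta> = ereal \<nu>"
      using \<delta> by (simp add: opt c \<nu>_def)
    have le: "global_exactness_param f \<phi> M A \<le> max (ereal l1) (ereal \<nu>)"
      if "threshold_on f \<phi> M A (penalty_sublevel \<phi> A \<delta>) l1" for l1
      unfolding global_exactness_param_def \<nu>_def ereal_max[symmetric]
      using threshold[OF \<delta> c_le that] by (intro Inf_lower) blast
    show ?thesis
    \<comment> \<open>To take the infimum over \<open>l1\<close> inside the maximum: if the
      parameter exceeds \<open>\<nu>\<close>, then \<open>le\<close> forces it below every local
      threshold \<open>l1\<close>, hence below their infimum.\<close>
    proof (cases "global_exactness_param f \<phi> M A \<le> ereal \<nu>")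
      case True
      then show ?thesis unfolding \<nu> by (simp add: le_max_iff_disj)
    next
      case False
      then have "global_exactness_param f \<phi> M A
          \<le> exactness_param_on f \<phi> M A (penalty_sublevel \<phi> A \<delta>)"
        unfolding exactness_param_on_def using le by (intro Inf_greatest) (auto simp: le_max_iff_disj)
      then show ?thesis by (simp add: le_max_iff_disj)
    qed
  qed
  ultimately show ?thesis by blast
qed

end
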